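(* Consider the problem $\min_{x\in\mathbb{R}^n}F(x)$ with $F=(F_1,\dots,F_m)$, $F_i=f_i+g_i$, where each $f_i$ is continuously differentiable and $L_i$-smooth and each $g_i$ is proper, convex and lower semicontinuous. Assume that $\Omega=\{x\in\mathbb{R}^n:F(x)\preceq F(x^0)\}$ is a bounded set. Let $\{x^k\}$ be the (infinite) sequence generated from $x^0$ by the adaptive Barzilai-Borwein proximal gradient method (ABBPGMO, described in the context). Then: (i) $\{x^k\}$ has at least one accumulation point, and every accumulation point $x^*\in\Omega$ is a Pareto critical point. (ii) For all $k\ge1$, $$\min_{0\le s\le k-1}\|x^{s+1}-x^s\|\le\frac{\sqrt{2\min_{i\in[m]}\{F_i(x^0)-F_i^*\}}}{\sqrt{\alpha_{\min}}\,\sqrt{k}},$$ where $F_i^*=\lim_{k\to\infty}F_i(x^k)$.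
   Context: Notation: $[m]=\{1,\dots,m\}$; for $u,v\in\mathbb{R}^m$, $u\preceq v$ means $u_i\le v_i$ for all $i$. $F:\mathbb{R}^n\to\mathbb{R}^m$. A point $x^*$ is Pareto critical if $\max_{i\in[m]}F_i'(x^*;d)\ge0$ for all $d\in\mathbb{R}^n$, where $F_i'(x;d)=\lim_{t\downarrow0}(F_i(x+td)-F_i(x))/t$. A differentiable $h$ is $L$-smooth if $\|\nabla h(y)-\nabla h(x)\|\le L\|y-x\|$ for all $x,y$. ABBPGMO. Fix $\tau>1$ and constants $0<\alpha_{\min}<\alpha_{\max}$ ($\alpha_{\min}$ sufficiently small, $\alpha_{\max}$ sufficiently large). Given $x^0$, choose $x^{-1}\ne x^0$ in a small neighborhood of $x^0$. For $\alpha\in\mathbb{R}^m$ with positive entries, let $P_\alpha(x^k)$ be the unique minimizer over $x\in\mathbb{R}^n$ of $\max_{i\in[m]}\left\{\frac{\langle\nabla f_i(x^k),x-x^k\rangle+g_i(x)-g_i(x^k)}{\alpha_i}+\frac12\|x-x^k\|^2\right\}$. For $k=0,1,2,\dots$: 1. With $s^{k-1}=x^k-x^{k-1}$ and $y_i^{k-1}=\nabla f_i(x^k)-\nabla f_i(x^{k-1})$, initialize for each $i\in[m]$: $\alpha_i^k=\max\{\alpha_{\min},\min\{\langle s^{k-1},y_i^{k-1}\rangle/\langle s^{k-1},s^{k-1}\rangle,\alpha_{\max}\}\}$ if $\langle s^{k-1},y_i^{k-1}\rangle>0$; $\alpha_i^k=\max\{\alpha_{\min},\min\{\|y_i^{k-1}\|/\|s^{k-1}\|,\alpha_{\max}\}\}$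 if $\langle s^{k-1},y_i^{k-1}\rangle<0$; $\alpha_i^k=\alpha_{\min}$ if $\langle s^{k-1},y_i^{k-1}\rangle=0$. 2. Set $x^{k+1}=P_{\alpha^k}(x^k)$; stop if $x^{k+1}=x^k$. 3. Repeat: for every $i$ with $f_i(x^{k+1})-f_i(x^k)>\langle\nabla f_i(x^k),x^{k+1}-x^k\rangle+\frac{\alpha_i^k}{2}\|x^{k+1}-x^k\|^2$ replace $\alpha_i^k$ by $\tau\alpha_i^k$; then recompute $x^{k+1}=P_{\alpha^k}(x^k)$; until $f_i(x^{k+1})-f_i(x^k)\le\langle\nabla f_i(x^k),x^{k+1}-x^k\rangle+\frac{\alpha_i^k}{2}\|x^{k+1}-x^k\|^2$ for all $i\in[m]$. Standing assumption: the algorithm does not stop, i.e. it produces an infinite sequence of points that are not Pareto critical. *)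

theory Defs
  imports "HOL-Analysis.Analysis"
begin

text \<open>
  Conventions: the index set \<open>[m]\<close> is a finite type \<open>'m\<close>, and \<open>\<real>\<^sup>n\<close> is \<open>real ^ 'n\<close>. The convex parts
  \<open>g\<^sub>i\<close>, hence the objectives \<open>F\<^sub>i\<close>, are extended-real-valued, as is usual for proper convex
  functions; real-valued \<open>g\<^sub>i\<close> are the special case \<open>g\<^sub>i = ereal \<circ> h\<^sub>i\<close>.
\<close>

subsection \<open>Smooth functions\<close>

definition gradient :: "('a::real_inner \<Rightarrow> real) \<Rightarrow> 'a \<Rightarrow> 'a" where
  "gradient h x = (THE D. GDERIV h x :> D)"

definition continuously_differentiable :: "('a::real_inner \<Rightarrow> real) \<Rightarrow> bool" where
  "continuously_differentiable h \<longleftrightarrow>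
     (\<forall>x. GDERIV h x :> gradient h x) \<and> continuous_on UNIV (gradient h)"

definition smooth_with :: "real \<Rightarrow> ('a::real_inner \<Rightarrow> real) \<Rightarrow> bool" where
  "smooth_with L h \<longleftrightarrow> (\<forall>x y. norm (gradient h y - gradient h x) \<le> L * norm (y - x))"

subsection \<open>Extended-real-valued convex functions\<close>

definition proper :: "('a \<Rightarrow> ereal) \<Rightarrow> bool" where
  "proper h \<longleftrightarrow> (\<forall>x. h x \<noteq> -\<infinity>) \<and> (\<exists>x. h x \<noteq> \<infinity>)"

definition ereal_convex :: "('a::real_vector \<Rightarrow> ereal) \<Rightarrow> bool" where
  "ereal_convex h \<longleftrightarrow>
     (\<forall>x y. \<forall>t\<in>{0<..<1::real}.
        h ((1 - t) *\<^sub>R x + t *\<^sub>R y) \<le> ereal (1 - t) * h x + ereal t * h y)"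

definition lower_semicontinuous :: "('a::topological_space \<Rightarrow> ereal) \<Rightarrow> bool" where
  "lower_semicontinuous h \<longleftrightarrow> (\<forall>x. h x \<le> Liminf (at x) h)"

subsection \<open>Composite multiobjective problems\<close>

definition objective ::
    "('m \<Rightarrow> 'a \<Rightarrow> real) \<Rightarrow> ('m \<Rightarrow> 'a \<Rightarrow> ereal) \<Rightarrow> 'm \<Rightarrow> 'a \<Rightarrow> ereal" where
  "objective f g i x = ereal (f i x) + g i x"

definition level_set :: "('m \<Rightarrow> 'a \<Rightarrow> ereal) \<Rightarrow> 'a \<Rightarrow> 'a set" where
  "level_set F x0 = {x. \<forall>i. F i x \<le> F i x0}"

definition dir_deriv :: "('a::real_vector \<Rightarrow> ereal) \<Rightarrow> 'a \<Rightarrow> 'a \<Rightarrow> ereal" where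
  "dir_deriv h x d = Lim (at_right 0) (\<lambda>t::real. (h (x + t *\<^sub>R d) - h x) / ereal t)"

definition pareto_critical :: "('m::finite \<Rightarrow> 'a::real_vector \<Rightarrow> ereal) \<Rightarrow> 'a \<Rightarrow> bool" where
  "pareto_critical F x \<longleftrightarrow> (\<forall>d. (MAX i. dir_deriv (F i) x d) \<ge> 0)"

definition accumulation_point :: "(nat \<Rightarrow> 'a::topological_space) \<Rightarrow> 'a \<Rightarrow> bool" where
  "accumulation_point x a \<longleftrightarrow> (\<exists>r::nat \<Rightarrow> nat. strict_mono r \<and> (x \<circ> r) \<longlonglongrightarrow> a)"

subsection \<open>The proximal gradient subproblem\<close>

definition prox_obj ::
    "('m::finite \<Rightarrow> 'a::real_inner \<Rightarrow> real) \<Rightarrow> ('m \<Rightarrow> 'a \<Rightarrow> ereal) \<Rightarrow>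
     ('m \<Rightarrow> real) \<Rightarrow> 'a \<Rightarrow> 'a \<Rightarrow> ereal" where
  "prox_obj f g \<alpha> x y =
     (MAX i. (ereal (gradient (f i) x \<bullet> (y - x)) + g i y - g i x) / ereal (\<alpha> i)
             + ereal (1/2 * (norm (y - x))\<^sup>2))"

text \<open>\<open>is_prox f g \<alpha> x p\<close> says \<open>p = P\<^sub>\<alpha>(x)\<close>, i.e. \<open>p\<close> is the unique minimizer of \<open>prox_obj f g \<alpha> x\<close>.\<close>

definition is_prox ::
    "('m::finite \<Rightarrow> 'a::real_inner \<Rightarrow> real) \<Rightarrow> ('m \<Rightarrow> 'a \<Rightarrow> ereal) \<Rightarrow>
     ('m \<Rightarrow> real) \<Rightarrow> 'a \<Rightarrow> 'a \<Rightarrow> bool" where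
  "is_prox f g \<alpha> x p \<longleftrightarrow>
     is_arg_min (prox_obj f g \<alpha> x) (\<lambda>_. True) p \<and>
     (\<forall>q. is_arg_min (prox_obj f g \<alpha> x) (\<lambda>_. True) q \<longrightarrow> q = p)"

subsection \<open>The adaptive Barzilai-Borwein proximal gradient method\<close>

definition bb_init :: "real \<Rightarrow> real \<Rightarrow> 'a::real_inner \<Rightarrow> 'a \<Rightarrow> real" where
  "bb_init \<alpha>min \<alpha>max s y =
     (if s \<bullet> y > 0 then max \<alpha>min (min ((s \<bullet> y) / (s \<bullet> s)) \<alpha>max)
      else if s \<bullet> y < 0 then max \<alpha>min (min (norm y / norm s) \<alpha>max)
      else \<alpha>min)"

definition descent_ok :: "('a::real_inner \<Rightarrow> real) \<Rightarrow> real \<Rightarrow> 'a \<Rightarrow> 'a \<Rightarrow> bool" where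
  "descent_ok h a x p \<longleftrightarrow> h p - h x \<le> gradient h x \<bullet> (p - x) + a / 2 * (norm (p - x))\<^sup>2"

definition enlarge ::
    "('m \<Rightarrow> 'a::real_inner \<Rightarrow> real) \<Rightarrow> real \<Rightarrow> 'a \<Rightarrow> ('m \<Rightarrow> real) \<Rightarrow> 'a \<Rightarrow> 'm \<Rightarrow> real" where
  "enlarge f \<tau> x \<alpha> p i = (if descent_ok (f i) (\<alpha> i) x p then \<alpha> i else \<tau> * \<alpha> i)"

text \<open>
  \<open>backtrack f g \<tau> x \<alpha> p p'\<close>: the repeat-until loop at the iterate \<open>x\<close>, entered with
  parameters \<open>\<alpha>\<close> and trial point \<open>p\<close>, terminates with the trial point \<open>p'\<close>.
\<close>

inductive backtrack ::
    "('m::finite \<Rightarrow> 'a::real_inner \<Rightarrow> real) \<Rightarrow> ('m \<Rightarrow> 'a \<Rightarrow> ereal) \<Rightarrow> real \<Rightarrow> 'a \<Rightarrow>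
     ('m \<Rightarrow> real) \<Rightarrow> 'a \<Rightarrow> 'a \<Rightarrow> bool"
  for f g \<tau> x where
  until: "\<lbrakk>\<alpha>' = enlarge f \<tau> x \<alpha> p; is_prox f g \<alpha>' x p'; \<forall>i. descent_ok (f i) (\<alpha>' i) x p'\<rbrakk>
     \<Longrightarrow> backtrack f g \<tau> x \<alpha> p p'"
| again: "\<lbrakk>\<alpha>' = enlarge f \<tau> x \<alpha> p; is_prox f g \<alpha>' x p'; \<not> (\<forall>i. descent_ok (f i) (\<alpha>' i) x p');
      backtrack f g \<tau> x \<alpha>' p' p''\<rbrakk>
     \<Longrightarrow> backtrack f g \<tau> x \<alpha> p p''"

text \<open>One non-stopping iteration, from the last two iterates \<open>xprev\<close>, \<open>x\<close> to the next one.\<close>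

definition abbpgmo_step ::
    "('m::finite \<Rightarrow> 'a::real_inner \<Rightarrow> real) \<Rightarrow> ('m \<Rightarrow> 'a \<Rightarrow> ereal) \<Rightarrow>
     real \<Rightarrow> real \<Rightarrow> real \<Rightarrow> 'a \<Rightarrow> 'a \<Rightarrow> 'a \<Rightarrow> bool" where
  "abbpgmo_step f g \<tau> \<alpha>min \<alpha>max xprev x xnext \<longleftrightarrow>
     (let \<alpha> = (\<lambda>i. bb_init \<alpha>min \<alpha>max (x - xprev) (gradient (f i) x - gradient (f i) xprev))
      in \<exists>p. is_prox f g \<alpha> x p \<and> p \<noteq> x \<and> backtrack f g \<tau> x \<alpha> p xnext)"

text \<open>
  An infinite run. The extra starting point \<open>x\<^sup>-\<^sup>1\<close> is \<open>xm1\<close>; how close it is to \<open>x\<^sup>0\<close> is left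
  unspecified.
\<close>

definition abbpgmo_run ::
    "('m::finite \<Rightarrow> 'a::real_inner \<Rightarrow> real) \<Rightarrow> ('m \<Rightarrow> 'a \<Rightarrow> ereal) \<Rightarrow>
     real \<Rightarrow> real \<Rightarrow> real \<Rightarrow> 'a \<Rightarrow> (nat \<Rightarrow> 'a) \<Rightarrow> bool" where
  "abbpgmo_run f g \<tau> \<alpha>min \<alpha>max xm1 x \<longleftrightarrow>
     xm1 \<noteq> x 0 \<and>
     (\<forall>k. abbpgmo_step f g \<tau> \<alpha>min \<alpha>max (case k of 0 \<Rightarrow> xm1 | Suc j \<Rightarrow> x j) (x k) (x (Suc k)))"

end

theory Submission
  imports Defs
begin

text \<open>
  Let \<open>\<theta>\<^sub>k\<close> be the optimal value of the accepted subproblem at \<open>x\<^sup>k\<close>. Strong convexity gives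
  \<open>\<theta>\<^sub>k \<le> -\<parallel>x\<^sup>k\<^sup>+\<^sup>1 - x\<^sup>k\<parallel>\<^sup>2/2\<close>, and the acceptance test turns this into
  \<open>F\<^sub>i(x\<^sup>k\<^sup>+\<^sup>1) \<le> F\<^sub>i(x\<^sup>k) + \<alpha>\<^sub>m\<^sub>i\<^sub>n \<theta>\<^sub>k\<close> for every \<open>i\<close>. Summation yields the rate and
  \<open>\<theta>\<^sub>k \<longlonglongrightarrow> 0\<close>. Smoothness keeps the accepted \<open>\<alpha>\<^sub>i\<^sup>k\<close> below \<open>max \<alpha>\<^sub>m\<^sub>a\<^sub>x (\<tau> L\<^sub>i)\<close>, so a common
  descent direction at an accumulation point would keep \<open>\<theta>\<^sub>k\<close> away from 0 along a subsequence.
\<close>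

section \<open>Descent inequality and bounds on the backtracked parameters\<close>

lemma has_real_derivative_along_line:
  fixes h :: "'a::real_inner \<Rightarrow> real"
  assumes "continuously_differentiable h"
  shows "((\<lambda>t. h (x + t *\<^sub>R d)) has_real_derivative gradient h (x + t *\<^sub>R d) \<bullet> d) (at t)"
proof -
  have "(\<lambda>v. v \<bullet> gradient h z) = (\<bullet>) (gradient h z)" for z
    by (simp add: fun_eq_iff inner_commute)
  then have "(h has_derivative (\<bullet>) (gradient h (x + t *\<^sub>R d))) (at (x + t *\<^sub>R d))"
    using assms by (simp add: continuously_differentiable_def gderiv_def)
  moreover have "((\<lambda>t. x + t *\<^sub>R d) has_derivative (\<lambda>s. s *\<^sub>R d)) (at t)"
    by (auto intro!: derivative_eq_intros)
  ultimately have "((\<lambda>t. h (x + t *\<^sub>R d)) has_derivative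
      (\<lambda>s. gradient h (x + t *\<^sub>R d) \<bullet> (s *\<^sub>R d))) (at t)"
    using has_derivative_compose[of "\<lambda>t. x + t *\<^sub>R d" "\<lambda>s. s *\<^sub>R d" t UNIV h] by blast
  then show ?thesis
    by (rule has_derivative_imp_has_field_derivative) simp
qed

text \<open>The gap between \<open>h\<close> and its quadratic model along the segment,
  \<open>\<psi>\<close>, has derivative at most 0 on [0,1] by Cauchy-Schwarz and the Lipschitz
  bound, so it suffices to compare its endpoints. The contrapositive drives the analysis of the
  loop: a failed test forces the parameter below \<open>L\<close>.\<close>

lemma descent_ok_of_smooth:
  fixes h :: "'a::real_inner \<Rightarrow> real"
  assumes cd: "continuously_differentiable h" and sm: "smooth_with L h" and "L \<le> a"
  shows "descent_ok h a x p"
proof -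
  define d where "d = p - x"
  define c where "c = gradient h x \<bullet> d"
  define \<psi> where "\<psi> t = h (x + t *\<^sub>R d) - t * c - L / 2 * t\<^sup>2 * (norm d)\<^sup>2" for t :: real
  have "\<psi> 1 \<le> \<psi> 0"
  proof (rule DERIV_nonpos_imp_nonincreasing[of 0 1 \<psi>])
    fix t :: real assume t: "0 \<le> t" "t \<le> 1"
    have "norm (gradient h (x + t *\<^sub>R d) - gradient h x) \<le> L * (t * norm d)"
      using sm[unfolded smooth_with_def, rule_format, of "x + t *\<^sub>R d" x] t by simp
    then have "(gradient h (x + t *\<^sub>R d) - gradient h x) \<bullet> d \<le> L * (t * norm d) * norm d"
      by (meson mult_right_mono norm_cauchy_schwarz norm_ge_zero order_trans)
    then have "gradient h (x + t *\<^sub>R d) \<bullet> d - c - L * t * (norm d)\<^sup>2 \<le> 0"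
      by (simp add: c_def inner_diff_left power2_eq_square algebra_simps)
    moreover have "(\<psi> has_real_derivative gradient h (x + t *\<^sub>R d) \<bullet> d - c - L * t * (norm d)\<^sup>2) (at t)"
      unfolding \<psi>_def by (rule derivative_eq_intros has_real_derivative_along_line[OF cd] refl | simp)+
    ultimately show "\<exists>y. DERIV \<psi> t :> y \<and> y \<le> 0" by blast
  qed simp
  then have "h p - h x \<le> gradient h x \<bullet> (p - x) + L / 2 * (norm (p - x))\<^sup>2"
    by (simp add: \<psi>_def c_def d_def)
  moreover have "L / 2 * (norm (p - x))\<^sup>2 \<le> a / 2 * (norm (p - x))\<^sup>2"
    using \<open>L \<le> a\<close> by (intro mult_right_mono) auto
  ultimately show ?thesis unfolding descent_ok_def by linarith
qed

text \<open>A parameter is multiplied by \<open>\<tau>\<close> only after a failed test, hence while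
  it is still below \<open>L i\<close>; the new value is then below \<open>\<tau> * L i\<close>.
  Since \<open>\<tau> > 1\<close>, the lower bound \<open>a\<close> survives too, and both bounds
  are an invariant of the loop.\<close>

lemma backtrack_result:
  assumes "backtrack f g \<tau> x \<alpha> p p'"
    and "\<And>i. continuously_differentiable (f i)" "\<And>i. smooth_with (L i) (f i)"
    and "\<tau> > 1" "0 < a" "\<And>i. \<tau> * L i \<le> B i" "\<And>i. a \<le> \<alpha> i \<and> \<alpha> i \<le> B i"
  obtains \<alpha>' where "\<And>i. a \<le> \<alpha>' i \<and> \<alpha>' i \<le> B i" "is_prox f g \<alpha>' x p'"
    "\<And>i. descent_ok (f i) (\<alpha>' i) x p'"
proof -
  have enl: "a \<le> enlarge f \<tau> x \<beta> q i \<and> enlarge f \<tau> x \<beta> q i \<le> B i"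
    if "\<And>i. a \<le> \<beta> i \<and> \<beta> i \<le> B i" for \<beta> q i
  proof (cases "descent_ok (f i) (\<beta> i) x q")
    case True
    then show ?thesis using that by (simp add: enlarge_def)
  next
    case False
    then have "\<beta> i < L i" using descent_ok_of_smooth assms(2,3) by (metis linorder_not_less)
    then have "\<tau> * \<beta> i \<le> B i"
      using assms(4) assms(6)[of i] by (smt (verit) mult_strict_left_mono)
    moreover have "a \<le> \<tau> * \<beta> i"
      using assms(4,5) that[of i] by (smt (verit) mult_le_cancel_right1)
    ultimately show ?thesis using False by (simp add: enlarge_def)
  qed
  have "\<exists>\<alpha>'. (\<forall>i. a \<le> \<alpha>' i \<and> \<alpha>' i \<le> B i) \<and> is_prox f g \<alpha>' x p' \<and>
      (\<forall>i. descent_ok (f i) (\<alpha>' i) x p')"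
    using assms(1,7)
  proof induction
    case (until \<alpha>' \<alpha> p p')
    then show ?case using enl by blast
  next
    case (again \<alpha>' \<alpha> p p' p'')
    then show ?case using enl by blast
  qed
  then show ?thesis using that by blast
qed

section \<open>Optimal value of the subproblem and decrease per iteration\<close>

lemma prox_term_real:
  assumes "p = ereal u" "q = ereal v" "a > 0"
  shows "(ereal c + p - q) / ereal a + ereal e = ereal ((c + u - v) / a + e)"
  using assms by simp

lemma is_prox_min: "is_prox f g \<alpha> x p \<Longrightarrow> prox_obj f g \<alpha> x p \<le> prox_obj f g \<alpha> x y"
  by (auto simp: is_prox_def is_arg_min_linorder)

text \<open>The subproblem is strongly convex with modulus 1 and vanishes at \<open>y = x\<close>, so its optimal
  value is at most \<open>-\<parallel>p - x\<parallel>\<^sup>2/2\<close>.\<close>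

lemma is_prox_value:
  fixes f :: "'m::finite \<Rightarrow> 'a::real_inner \<Rightarrow> real"
  assumes prox: "is_prox f g \<alpha> x p" and pos: "\<And>i. \<alpha> i > 0"
    and pr: "\<And>i. proper (g i)" and cv: "\<And>i. ereal_convex (g i)"
    and fin: "\<And>i. g i x = ereal (v i)"
  obtains u \<theta> where "\<And>i. g i p = ereal (u i)" "prox_obj f g \<alpha> x p = ereal \<theta>"
    "\<theta> \<le> - (norm (p - x))\<^sup>2 / 2"
    "\<And>i. (gradient (f i) x \<bullet> (p - x) + u i - v i) / \<alpha> i + (norm (p - x))\<^sup>2 / 2 \<le> \<theta>"
proof -
  define c where "c i y = gradient (f i) x \<bullet> (y - x)" for i y
  define T where "T i y = (ereal (c i y) + g i y - g i x) / ereal (\<alpha> i) + ereal (1/2 * (norm (y - x))\<^sup>2)"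
    for i y
  have obj: "prox_obj f g \<alpha> x y = (MAX i. T i y)" for y
    by (simp add: prox_obj_def T_def c_def)
  have Tle: "T i y \<le> prox_obj f g \<alpha> x y" for i y
    unfolding obj by (rule Max_ge) auto
  have "T i x = 0" for i by (simp add: T_def c_def fin)
  then have "prox_obj f g \<alpha> x x = 0" unfolding obj by simp
  then have le0: "prox_obj f g \<alpha> x p \<le> 0" using is_prox_min[OF prox, of x] by simp
  have "\<exists>w. g i p = ereal w" for i
  proof -
    \<comment> \<open>An infinite \<open>g i p\<close> would make this term infinite; thus the
      minimizer stays in the domain of every \<open>g i\<close>.\<close>
    have "T i p \<le> 0" using Tle le0 order_trans by blast
    then have "g i p \<noteq> \<infinity>" using pos[of i] by (auto simp: T_def fin)
    then show ?thesis using pr[of i] by (cases "g i p") (auto simp: proper_def)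
  qed
  then obtain u where u: "\<And>i. g i p = ereal (u i)" by metis
  define R where "R i = (c i p + u i - v i) / \<alpha> i + (norm (p - x))\<^sup>2 / 2" for i
  have TR: "T i p = ereal (R i)" for i
    unfolding T_def using prox_term_real[OF u fin pos] by (simp add: R_def)
  define \<theta> where "\<theta> = (MAX i. R i)"
  have \<theta>: "prox_obj f g \<alpha> x p = ereal \<theta>"
  proof -
    have "(MAX i. T i p) = Max (ereal ` range R)" by (simp add: TR image_image)
    also have "\<dots> = ereal (Max (range R))"
      by (rule mono_Max_commute[symmetric]) (auto simp: mono_def)
    finally show ?thesis by (simp add: obj \<theta>_def)
  qed
  have R\<theta>: "R i \<le> \<theta>" for i unfolding \<theta>_def by (rule Max_ge) auto
  define N where "N = (norm (p - x))\<^sup>2"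
  \<comment> \<open>The minimizer is compared with the point \<open>y\<close> a fraction
    \<open>t\<close> of the way towards \<open>x\<close>. There the linear and convex parts are at
    most \<open>1 - t\<close> times their values at \<open>p\<close>, while the squared distance
    shrinks by the factor \<open>(1 - t)\<^sup>2\<close>. The surplus
    \<open>t * (1 - t) * N / 2\<close> remains; dividing by \<open>t\<close> and letting
    \<open>t\<close> tend to 0 gives the claim.\<close>
  have bound: "\<theta> \<le> - (1 - t) * N / 2" if t: "0 < t" "t < 1" for t
  proof -
    define y where "y = (1 - t) *\<^sub>R p + t *\<^sub>R x"
    have yx: "y - x = (1 - t) *\<^sub>R (p - x)" by (simp add: y_def algebra_simps)
    have "T i y \<le> ereal ((1 - t) * \<theta> - t * (1 - t) * N / 2)" for i
    proof -
      have "g i y \<le> ereal (1 - t) * g i p + ereal t * g i x"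
        using cv[of i] t unfolding ereal_convex_def y_def by auto
      then have le: "g i y \<le> ereal ((1 - t) * u i + t * v i)" by (simp add: u fin)
      moreover have "g i y \<noteq> -\<infinity>" using pr[of i] by (simp add: proper_def)
      ultimately obtain w where w: "g i y = ereal w" by (cases "g i y") auto
      have cy: "c i y = (1 - t) * c i p" by (simp add: c_def yx)
      have ny: "(norm (y - x))\<^sup>2 = (1 - t)\<^sup>2 * N" by (simp add: yx N_def power_mult_distrib)
      have "c i y + w - v i \<le> (1 - t) * (c i p + u i - v i)"
        using le w by (simp add: cy algebra_simps)
      then have "(c i y + w - v i) / \<alpha> i \<le> (1 - t) * (c i p + u i - v i) / \<alpha> i"
        by (rule divide_right_mono) (use pos[of i] in simp)
      also have "\<dots> = (1 - t) * (R i - N / 2)" by (simp add: R_def N_def)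
      also have "\<dots> \<le> (1 - t) * (\<theta> - N / 2)" using R\<theta>[of i] t by (intro mult_left_mono) auto
      moreover have eq: "(1 - t) * (\<theta> - N / 2) + 1/2 * ((1 - t)\<^sup>2 * N)
          = (1 - t) * \<theta> - t * (1 - t) * N / 2"
        by (simp add: field_simps power2_eq_square)
      ultimately have "(c i y + w - v i) / \<alpha> i + 1/2 * (norm (y - x))\<^sup>2
          \<le> (1 - t) * \<theta> - t * (1 - t) * N / 2"
        unfolding ny using eq by linarith
      then show ?thesis unfolding T_def using prox_term_real[OF w fin pos] by simp
    qed
    then have "prox_obj f g \<alpha> x y \<le> ereal ((1 - t) * \<theta> - t * (1 - t) * N / 2)"
      unfolding obj by (subst Max_le_iff) auto
    then have "ereal \<theta> \<le> ereal ((1 - t) * \<theta> - t * (1 - t) * N / 2)"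
      using is_prox_min[OF prox, of y] \<theta> by (metis order_trans)
    then have "t * \<theta> \<le> t * (- (1 - t) * N / 2)" by (simp add: field_simps)
    then show ?thesis using t by simp
  qed
  have "\<theta> \<le> - (1 - 0) * N / 2"
  proof (rule tendsto_lowerbound)
    show "((\<lambda>t. - (1 - t) * N / 2) \<longlongrightarrow> - (1 - 0) * N / 2) (at_right (0::real))"
      by (intro tendsto_intros) simp
    show "eventually (\<lambda>t. \<theta> \<le> - (1 - t) * N / 2) (at_right (0::real))"
      using bound unfolding eventually_at_right_field by (intro exI[of _ 1]) auto
  qed simp
  then have "\<theta> \<le> - (norm (p - x))\<^sup>2 / 2" by (simp add: N_def)
  then show ?thesis using that u \<theta> R\<theta> unfolding R_def c_def by blast
qed

lemma bb_init_bounds: "a \<le> b \<Longrightarrow> a \<le> bb_init a b s y \<and> bb_init a b s y \<le> b"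
  by (auto simp: bb_init_def)

text \<open>Multiplying the \<open>i\<close>-th term of the subproblem by \<open>\<alpha> i\<close>
  produces exactly the right-hand side of the acceptance test plus the change of \<open>g i\<close>.
  This gives a decrease by \<open>\<alpha> i * \<theta>\<close>, and since \<open>\<theta>\<close>
  is nonpositive, \<open>\<alpha> i\<close> may be replaced by the smaller
  \<open>\<alpha>min\<close>, uniformly in \<open>i\<close>.\<close>

lemma abbpgmo_step_decrease:
  fixes f :: "'m::finite \<Rightarrow> 'a::real_inner \<Rightarrow> real"
  assumes "abbpgmo_step f g \<tau> \<alpha>min \<alpha>max xprev x p"
    and "\<And>i. continuously_differentiable (f i)" "\<And>i. smooth_with (L i) (f i)"
    and "\<And>i. proper (g i)" "\<And>i. ereal_convex (g i)"
    and "\<tau> > 1" "0 < \<alpha>min" "\<alpha>min < \<alpha>max"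
    and fin: "\<And>i. g i x = ereal (v i)"
  obtains \<alpha> u \<theta> where "\<And>i. \<alpha>min \<le> \<alpha> i \<and> \<alpha> i \<le> max \<alpha>max (\<tau> * L i)"
    "\<And>i. g i p = ereal (u i)" "\<And>y. ereal \<theta> \<le> prox_obj f g \<alpha> x y"
    "\<theta> \<le> - (norm (p - x))\<^sup>2 / 2" "\<And>i. f i p + u i \<le> f i x + v i + \<alpha>min * \<theta>"
proof -
  let ?a = "\<lambda>i. bb_init \<alpha>min \<alpha>max (x - xprev) (gradient (f i) x - gradient (f i) xprev)"
  obtain q where q: "backtrack f g \<tau> x ?a q p"
    using assms(1) by (auto simp: abbpgmo_step_def Let_def)
  have ini: "\<alpha>min \<le> ?a i \<and> ?a i \<le> max \<alpha>max (\<tau> * L i)" for i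
    using bb_init_bounds[of \<alpha>min \<alpha>max] assms(8) by (metis less_imp_le max.coboundedI1)
  obtain \<alpha> where \<alpha>: "\<And>i. \<alpha>min \<le> \<alpha> i \<and> \<alpha> i \<le> max \<alpha>max (\<tau> * L i)" "is_prox f g \<alpha> x p"
    "\<And>i. descent_ok (f i) (\<alpha> i) x p"
    by (rule backtrack_result[OF q assms(2,3,6,7), where B = "\<lambda>i. max \<alpha>max (\<tau> * L i)"])
      (use ini in auto)
  have pos: "\<alpha> i > 0" for i using \<alpha>(1)[of i] assms(7) by linarith
  obtain u \<theta> where u: "\<And>i. g i p = ereal (u i)" "prox_obj f g \<alpha> x p = ereal \<theta>"
    "\<theta> \<le> - (norm (p - x))\<^sup>2 / 2"
    "\<And>i. (gradient (f i) x \<bullet> (p - x) + u i - v i) / \<alpha> i + (norm (p - x))\<^sup>2 / 2 \<le> \<theta>"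
    using is_prox_value[where f = f and g = g, OF \<alpha>(2) pos assms(4,5) fin] by metis
  have dec: "f i p + u i \<le> f i x + v i + \<alpha>min * \<theta>" for i
  proof -
    have "\<alpha> i * ((gradient (f i) x \<bullet> (p - x) + u i - v i) / \<alpha> i + (norm (p - x))\<^sup>2 / 2) \<le> \<alpha> i * \<theta>"
      using u(4) pos[of i] by (intro mult_left_mono) auto
    then have "gradient (f i) x \<bullet> (p - x) + u i - v i + \<alpha> i / 2 * (norm (p - x))\<^sup>2 \<le> \<alpha> i * \<theta>"
      using pos[of i] by (simp add: distrib_left)
    moreover have "\<alpha> i * \<theta> \<le> \<alpha>min * \<theta>"
      using \<alpha>(1)[of i] u(3) by (intro mult_right_mono_neg) (auto intro: order_trans)
    ultimately show ?thesis using \<alpha>(3)[of i] unfolding descent_ok_def by linarith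
  qed
  have "ereal \<theta> \<le> prox_obj f g \<alpha> x y" for y
    using is_prox_min[OF \<alpha>(2)] by (simp flip: u(2))
  then show ?thesis using that[OF \<alpha>(1) u(1) _ u(3) dec] by blast
qed

section \<open>Lower semicontinuity along the iterates\<close>

text \<open>The filter \<open>nhds x\<close> is used instead of the punctured \<open>at x\<close> so
  that the bound applies to sequences that may hit their limit; the value at \<open>x\<close> itself
  is covered by \<open>c < h x\<close>.\<close>

lemma lower_semicontinuous_eventually:
  assumes "lower_semicontinuous h" "c < h x"
  shows "eventually (\<lambda>y. c < h y) (nhds x)"
proof -
  have "c < Liminf (at x) h" using assms by (auto simp: lower_semicontinuous_def intro: less_le_trans)
  then have "eventually (\<lambda>y. c < h y) (at x)" by (rule less_LiminfD)
  then show ?thesis using assms(2) unfolding eventually_at_filter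
    by (auto elim!: eventually_mono)
qed

text \<open>If the limit value exceeded the value at index \<open>K\<close>, lower semicontinuity
  would push the tail of the subsequence above it as well, against monotonicity. The real number
  \<open>h xs\<close> stands on the right so that the bound also excludes the value infinity for
  \<open>G xs\<close>.\<close>

lemma decseq_lsc_bound:
  fixes h :: "'a::t2_space \<Rightarrow> real"
  assumes h: "isCont h xs" and lsc: "lower_semicontinuous G"
    and G: "\<And>k. G (x k) = ereal (v k)" and dec: "decseq (\<lambda>k. h (x k) + v k)"
    and r: "strict_mono r" "(x \<circ> r) \<longlonglongrightarrow> xs"
  shows "G xs \<le> ereal (h (x K) + v K - h xs)"
proof (rule ccontr)
  assume "\<not> ?thesis"
  then have "ereal (h (x K) + v K - h xs) < G xs" by simp
  then obtain c where c: "h (x K) + v K - h xs < c" "ereal c < G xs"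
    using ereal_dense2 by (metis less_ereal.simps(1))
  have hx: "(\<lambda>n. h ((x \<circ> r) n) + c) \<longlonglongrightarrow> h xs + c"
    by (intro tendsto_intros isCont_tendsto_compose[OF h r(2)])
  have "eventually (\<lambda>n. ereal c < G ((x \<circ> r) n)) sequentially"
    using lower_semicontinuous_eventually[OF lsc c(2)] r(2) unfolding filterlim_iff by blast
  moreover have "eventually (\<lambda>n. K \<le> n) sequentially" by (rule eventually_ge_at_top)
  ultimately have "eventually (\<lambda>n. h ((x \<circ> r) n) + c \<le> h (x K) + v K) sequentially"
  proof eventually_elim
    case (elim n)
    then have "K \<le> r n" using seq_suble[OF r(1), of n] by linarith
    then have "h (x (r n)) + v (r n) \<le> h (x K) + v K" using dec by (simp add: decseq_def)
    then show ?case using elim G[of "r n"] by simp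
  qed
  then have "h xs + c \<le> h (x K) + v K" using tendsto_upperbound[OF hx] by simp
  then show False using c(1) by simp
qed

section \<open>Directional derivatives and criticality of limits\<close>

text \<open>The point \<open>x + s *\<^sub>R d\<close> is the convex combination of \<open>x\<close>
  and \<open>x + t *\<^sub>R d\<close> with weight \<open>s / t\<close> on the latter. If
  \<open>h\<close> is infinite at the farther point, the right-hand quotient is infinite.\<close>

lemma convex_quotient_mono:
  fixes h :: "'a::real_vector \<Rightarrow> ereal"
  assumes cv: "ereal_convex h" and pr: "proper h" and hx: "h x = ereal v" and st: "0 < s" "s \<le> t"
  shows "(h (x + s *\<^sub>R d) - h x) / ereal s \<le> (h (x + t *\<^sub>R d) - h x) / ereal t"
proof (cases "h (x + t *\<^sub>R d)")
  case (real w)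
  have "h (x + s *\<^sub>R d) \<le> ereal ((1 - s / t) * v + s / t * w)"
  proof (cases "s = t")
    case True
    then show ?thesis using real st by simp
  next
    case False
    then have "s / t \<in> {0<..<1}" using st by simp
    moreover have "(1 - s / t) *\<^sub>R x + (s / t) *\<^sub>R (x + t *\<^sub>R d) = x + s *\<^sub>R d"
      using st by (simp add: algebra_simps)
    ultimately show ?thesis
      using cv[unfolded ereal_convex_def, rule_format, of "s / t" x "x + t *\<^sub>R d"] real hx by simp
  qed
  moreover have "h (x + s *\<^sub>R d) \<noteq> -\<infinity>" using pr by (simp add: proper_def)
  ultimately obtain z where z: "h (x + s *\<^sub>R d) = ereal z" "z \<le> (1 - s / t) * v + s / t * w"
    by (cases "h (x + s *\<^sub>R d)") auto
  have "z - v \<le> s * ((w - v) / t)" using z(2) by (simp add: algebra_simps diff_divide_distrib)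
  then have "(z - v) / s \<le> (w - v) / t" using st by (simp add: pos_divide_le_eq mult.commute)
  then show ?thesis using z real hx st by simp
next
  case PInf
  then show ?thesis using st hx by simp
next
  case MInf
  then show ?thesis using pr by (simp add: proper_def)
qed

text \<open>Monotonicity makes the convex quotient converge, possibly to \<open>-\<infinity>\<close>; hence the \<open>THE\<close> behind
  \<open>Lim\<close> in \<open>dir_deriv\<close> is never vacuous here.\<close>

lemma objective_quotient_tendsto:
  fixes f :: "'m \<Rightarrow> 'a::real_inner \<Rightarrow> real"
  assumes cd: "continuously_differentiable (f i)"
    and cv: "ereal_convex (g i)" and pr: "proper (g i)" and gx: "g i x = ereal v"
  shows "((\<lambda>t. ereal (gradient (f i) x \<bullet> d) + (g i (x + t *\<^sub>R d) - g i x) / ereal t)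
      \<longlongrightarrow> dir_deriv (objective f g i) x d) (at_right 0)"
proof -
  define q where "q t = (g i (x + t *\<^sub>R d) - g i x) / ereal t" for t
  define l where "l = (INF t\<in>{0<..}. q t)"
  have q: "(q \<longlongrightarrow> l) (at_right 0)"
  proof (rule order_tendstoI)
    fix a assume "a < l"
    then have "a < q t" if "t > 0" for t
      using that by (auto simp: l_def intro: less_le_trans INF_lower)
    then show "eventually (\<lambda>t. a < q t) (at_right 0)"
      unfolding eventually_at_right_field by (intro exI[of _ 1]) auto
  next
    fix a assume "l < a"
    then obtain t0 where "t0 > 0" "q t0 < a" by (auto simp: l_def INF_less_iff)
    moreover have "q t \<le> q t0" if "0 < t" "t < t0" for t
      unfolding q_def by (rule convex_quotient_mono[OF cv pr gx]) (use that in auto)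
    ultimately show "eventually (\<lambda>t. q t < a) (at_right 0)"
      unfolding eventually_at_right_field by (intro exI[of _ t0]) (auto intro: le_less_trans)
  qed
  define p where "p t = (f i (x + t *\<^sub>R d) - f i x) / t" for t
  have "((\<lambda>t. f i (x + t *\<^sub>R d)) has_real_derivative gradient (f i) x \<bullet> d) (at 0)"
    using has_real_derivative_along_line[OF cd, of x d 0] by simp
  then have "(p \<longlongrightarrow> gradient (f i) x \<bullet> d) (at 0)"
    by (simp add: DERIV_def p_def[abs_def])
  then have p: "((\<lambda>t. ereal (p t)) \<longlongrightarrow> ereal (gradient (f i) x \<bullet> d)) (at_right 0)"
    by (intro tendsto_ereal) (auto intro: tendsto_within_subset[where S = UNIV])
  have eq: "ereal (p t) + q t = (objective f g i (x + t *\<^sub>R d) - objective f g i x) / ereal t"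
    if "t > 0" for t
    using that pr unfolding proper_def
    by (cases "g i (x + t *\<^sub>R d)") (auto simp: p_def q_def objective_def gx field_simps)
  \<comment> \<open>The smooth summand has a finite limit, so addition is continuous here even when
    \<open>l\<close> is infinite.\<close>
  have "((\<lambda>t. ereal (p t) + q t) \<longlongrightarrow> ereal (gradient (f i) x \<bullet> d) + l) (at_right 0)"
    by (rule tendsto_add_ereal_general[OF _ p q]) auto
  then have "((\<lambda>t. (objective f g i (x + t *\<^sub>R d) - objective f g i x) / ereal t)
      \<longlongrightarrow> ereal (gradient (f i) x \<bullet> d) + l) (at_right 0)"
    by (rule Lim_transform_eventually) (auto simp: eventually_at_right_field eq intro!: exI[of _ 1])
  then have "dir_deriv (objective f g i) x d = ereal (gradient (f i) x \<bullet> d) + l"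
    unfolding dir_deriv_def by (intro tendsto_Lim) auto
  \<comment> \<open>The limit is unchanged when the quotient of \<open>f i\<close> is replaced by
    its own limit; in this form it concerns the linearized model of the subproblem.\<close>
  moreover have "((\<lambda>t. ereal (gradient (f i) x \<bullet> d) + q t)
      \<longlongrightarrow> ereal (gradient (f i) x \<bullet> d) + l) (at_right 0)"
    by (rule tendsto_add_ereal_general[OF _ tendsto_const q]) auto
  ultimately show ?thesis by (simp add: q_def)
qed

text \<open>Translates failure of criticality into a decrease, linear in \<open>t\<close>, of all
  linearized models at once. A real \<open>e\<close> strictly between the largest directional
  derivative and 0 bounds each quotient for small \<open>t\<close>; multiplying by \<open>t\<close>
  gives the claim with \<open>c = - e\<close>, and finitely many indices share one range of
  \<open>t\<close>.\<close>

lemma noncritical_model_decrease: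
  fixes f :: "'m::finite \<Rightarrow> 'a::real_inner \<Rightarrow> real"
  assumes cd: "\<And>i. continuously_differentiable (f i)"
    and cv: "\<And>i. ereal_convex (g i)" and pr: "\<And>i. proper (g i)"
    and gx: "\<And>i. g i x = ereal (v i)" and nc: "\<not> pareto_critical (objective f g) x"
  obtains d c where "c > 0" "eventually (\<lambda>t. \<forall>i. \<exists>w. g i (x + t *\<^sub>R d) = ereal w \<and>
      gradient (f i) x \<bullet> (t *\<^sub>R d) + w - v i < - t * c) (at_right 0)"
proof -
  obtain d where d: "(MAX i. dir_deriv (objective f g i) x d) < 0"
    using nc by (auto simp: pareto_critical_def not_le)
  then obtain e where e: "(MAX i. dir_deriv (objective f g i) x d) < ereal e" "e < 0"
    using ereal_dense2[OF d] by auto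
  have "eventually (\<lambda>t. \<exists>w. g i (x + t *\<^sub>R d) = ereal w \<and>
      gradient (f i) x \<bullet> (t *\<^sub>R d) + w - v i < - t * (- e)) (at_right 0)" for i
  proof -
    have "dir_deriv (objective f g i) x d < ereal e"
      using e(1) by (subst (asm) Max_less_iff) auto
    from order_tendstoD(2)[OF objective_quotient_tendsto[where f = f and g = g, OF cd cv pr gx] this]
    have "eventually (\<lambda>t. ereal (gradient (f i) x \<bullet> d) + (g i (x + t *\<^sub>R d) - g i x) / ereal t
        < ereal e) (at_right 0)" .
    moreover have "eventually (\<lambda>t::real. t > 0) (at_right 0)" by (simp add: eventually_at_right_less)
    ultimately show ?thesis
    proof eventually_elim
      case (elim t)
      then have "g i (x + t *\<^sub>R d) \<noteq> \<infinity>" by (auto simp: gx)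
      then obtain w where w: "g i (x + t *\<^sub>R d) = ereal w"
        using pr[of i] by (cases "g i (x + t *\<^sub>R d)") (auto simp: proper_def)
      then have "gradient (f i) x \<bullet> d + (w - v i) / t < e" using elim by (simp add: gx)
      then have "t * (gradient (f i) x \<bullet> d + (w - v i) / t) < t * e" using elim by simp
      then show ?case using w elim by (simp add: distrib_left)
    qed
  qed
  then have "eventually (\<lambda>t. \<forall>i. \<exists>w. g i (x + t *\<^sub>R d) = ereal w \<and>
      gradient (f i) x \<bullet> (t *\<^sub>R d) + w - v i < - t * (- e)) (at_right 0)"
    by (rule eventually_all_finite)
  then show ?thesis using that[of "- e" d] e(2) by simp
qed

text \<open>No limit of the parameters \<open>\<alpha>\<close> and no multipliers are needed: a common descent direction at
  \<open>x\<close> would make the subproblems at \<open>X k\<close> have optimal values bounded away from 0.\<close>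

lemma limit_of_prox_points_critical:
  fixes f :: "'m::finite \<Rightarrow> 'a::real_inner \<Rightarrow> real"
  assumes cd: "\<And>i. continuously_differentiable (f i)"
    and cv: "\<And>i. ereal_convex (g i)" and pr: "\<And>i. proper (g i)"
    and lsc: "\<And>i. lower_semicontinuous (g i)"
    and gx: "\<And>i. g i x = ereal (v i)" and X: "X \<longlonglongrightarrow> x"
    and gX: "\<And>k i. g i (X k) = ereal (V i k)"
    and \<alpha>: "\<And>k i. 0 < \<alpha> k i \<and> \<alpha> k i \<le> A"
    and \<theta>: "\<And>k y. ereal (\<theta> k) \<le> prox_obj f g (\<alpha> k) (X k) y" "\<theta> \<longlonglongrightarrow> 0"
  shows "pareto_critical (objective f g) x"
proof (rule ccontr)
  assume nc: "\<not> ?thesis"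
  obtain d c where c: "c > 0" "eventually (\<lambda>t. \<forall>i. \<exists>w. g i (x + t *\<^sub>R d) = ereal w \<and>
      gradient (f i) x \<bullet> (t *\<^sub>R d) + w - v i < - t * c) (at_right 0)"
    by (rule noncritical_model_decrease[where f = f and g = g, OF cd cv pr gx nc])
  \<comment> \<open>Types are inhabited, so \<open>undefined\<close> serves as some index.\<close>
  have A: "A > 0" using \<alpha>[of 0 undefined] by linarith
  \<comment> \<open>With parameters at most \<open>A\<close>, the model gains at least
    \<open>t * c / A\<close> at the trial point and pays half of
    \<open>t\<^sup>2 * (norm d)\<^sup>2\<close>; \<open>t\<close> is taken so small that the gain
    outweighs even twice this cost.\<close>
  have "((\<lambda>t. t * (norm d)\<^sup>2) \<longlongrightarrow> 0 * (norm d)\<^sup>2) (at_right 0)" by (intro tendsto_intros)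
  then have "eventually (\<lambda>t. t * (norm d)\<^sup>2 < c / A) (at_right 0)"
    by (rule order_tendstoD) (use c A in simp)
  moreover have "eventually (\<lambda>t::real. t > 0) (at_right 0)" by (simp add: eventually_at_right_less)
  ultimately have "eventually (\<lambda>t. t > 0 \<and> t * (norm d)\<^sup>2 < c / A \<and>
      (\<forall>i. \<exists>w. g i (x + t *\<^sub>R d) = ereal w \<and>
        gradient (f i) x \<bullet> (t *\<^sub>R d) + w - v i < - t * c)) (at_right 0)"
    using c(2) by eventually_elim auto
  then obtain t where t: "t > 0" "t * (norm d)\<^sup>2 < c / A"
    and "\<forall>i. \<exists>w. g i (x + t *\<^sub>R d) = ereal w \<and> gradient (f i) x \<bullet> (t *\<^sub>R d) + w - v i < - t * c"
    using eventually_happens'[OF trivial_limit_at_right_real] by blast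
  then obtain w where w: "\<And>i. g i (x + t *\<^sub>R d) = ereal (w i)"
    "\<And>i. gradient (f i) x \<bullet> (t *\<^sub>R d) + w i - v i < - t * c" by metis
  define y where "y = x + t *\<^sub>R d"
  \<comment> \<open>The trial point \<open>y\<close> stays fixed while the base point
    \<open>X k\<close> moves. Half of the slack \<open>\<epsilon>\<close> absorbs the change of the
    gradient term; the other half absorbs that of \<open>V i k\<close>, which enters with a minus
    sign and so calls for a lower bound.\<close>
  have ev: "eventually (\<lambda>k. gradient (f i) (X k) \<bullet> (y - X k) + w i - V i k < - t * c) sequentially" for i
  proof -
    define \<epsilon> where "\<epsilon> = - t * c - (gradient (f i) x \<bullet> (t *\<^sub>R d) + w i - v i)"
    have \<epsilon>_eq: "gradient (f i) x \<bullet> (t *\<^sub>R d) + w i - v i + \<epsilon> = - t * c" by (simp add: \<epsilon>_def)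
    have \<epsilon>: "\<epsilon> > 0" using w(2)[of i] by (simp add: \<epsilon>_def)
    have "isCont (gradient (f i)) x"
      using cd[of i] by (simp add: continuously_differentiable_def continuous_on_eq_continuous_at)
    then have "(\<lambda>k. gradient (f i) (X k) \<bullet> (y - X k)) \<longlonglongrightarrow> gradient (f i) x \<bullet> (y - x)"
      by (intro tendsto_intros isCont_tendsto_compose[OF _ X] X)
    then have "eventually (\<lambda>k. gradient (f i) (X k) \<bullet> (y - X k)
        < gradient (f i) x \<bullet> (t *\<^sub>R d) + \<epsilon> / 2) sequentially"
      by (rule order_tendstoD) (use \<epsilon> in \<open>simp add: y_def\<close>)
    moreover have "ereal (v i - \<epsilon> / 2) < g i x" using \<epsilon> by (simp add: gx)
    then have "eventually (\<lambda>k. ereal (v i - \<epsilon> / 2) < g i (X k)) sequentially"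
      using lower_semicontinuous_eventually[OF lsc] X unfolding filterlim_iff by blast
    ultimately show ?thesis
    proof eventually_elim
      case (elim k)
      then have "v i - \<epsilon> / 2 < V i k" by (simp add: gX)
      then show ?case using elim(1) \<epsilon>_eq by linarith
    qed
  qed
  \<comment> \<open>Negative by the choice of \<open>t\<close>. The limiting model bound
    \<open>- t * c / A + 1/2 * (norm (y - x))\<^sup>2\<close> lies strictly below
    \<open>\<delta> / 2\<close>, so for large \<open>k\<close> the model value at \<open>y\<close>
    is at most \<open>\<delta> / 2\<close>, whereas \<open>\<theta> k\<close> tends to 0.\<close>
  define \<delta> where "\<delta> = - t * c / A + t * (t * (norm d)\<^sup>2)"
  have "\<delta> < 0"
    using mult_strict_left_mono[OF t(2,1)] by (simp add: \<delta>_def)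
  have norm: "(\<lambda>k. 1/2 * (norm (y - X k))\<^sup>2) \<longlonglongrightarrow> 1/2 * (norm (y - x))\<^sup>2"
    by (intro tendsto_intros X)
  have "1/2 * (norm (y - x))\<^sup>2 = 1/2 * (t * (t * (norm d)\<^sup>2))"
    by (simp add: y_def power_mult_distrib power2_eq_square)
  moreover have "t * c / A > 0" using t c A by simp
  ultimately have lt: "1/2 * (norm (y - x))\<^sup>2 < \<delta> / 2 + t * c / A"
    unfolding \<delta>_def by argo
  have "eventually (\<lambda>k. \<delta> / 2 < \<theta> k) sequentially"
    by (rule order_tendstoD(1)[OF \<theta>(2)]) (use \<open>\<delta> < 0\<close> in simp)
  moreover have "eventually (\<lambda>k. 1/2 * (norm (y - X k))\<^sup>2 < \<delta> / 2 + t * c / A) sequentially"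
    by (rule order_tendstoD(2)[OF norm lt])
  moreover have "eventually (\<lambda>k. \<forall>i. gradient (f i) (X k) \<bullet> (y - X k) + w i - V i k < - t * c) sequentially"
    by (rule eventually_all_finite) (rule ev)
  ultimately have "eventually (\<lambda>k. False) sequentially"
  proof eventually_elim
    case (elim k)
    have "(ereal (gradient (f i) (X k) \<bullet> (y - X k)) + g i y - g i (X k)) / ereal (\<alpha> k i)
        + ereal (1/2 * (norm (y - X k))\<^sup>2) \<le> ereal (\<delta> / 2)" for i
    proof -
      have "(gradient (f i) (X k) \<bullet> (y - X k) + w i - V i k) / \<alpha> k i \<le> - t * c / \<alpha> k i"
        using elim(3) \<alpha>[of k i] by (intro divide_right_mono) (auto intro: less_imp_le)
      also have "\<dots> \<le> - (t * c / A)"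
        using \<alpha>[of k i] t c by (simp add: frac_le)
      finally have "(gradient (f i) (X k) \<bullet> (y - X k) + w i - V i k) / \<alpha> k i
          + 1/2 * (norm (y - X k))\<^sup>2 \<le> \<delta> / 2" using elim(2) by linarith
      moreover have "g i y = ereal (w i)" by (simp add: w y_def)
      ultimately show ?thesis using prox_term_real[of "g i y" "w i" "g i (X k)" "V i k"] gX \<alpha>[of k i] by simp
    qed
    then have "prox_obj f g (\<alpha> k) (X k) y \<le> ereal (\<delta> / 2)"
      unfolding prox_obj_def by (subst Max_le_iff) auto
    then have "ereal (\<theta> k) \<le> ereal (\<delta> / 2)" using \<theta>(1) order_trans by blast
    then show ?case using elim(1) by simp
  qed
  then show False by simp
qed

section \<open>Convergence of the values, critical accumulation points and the rate\<close>

theorem theorem4p4: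
  fixes f :: "'m::finite \<Rightarrow> real ^ 'n \<Rightarrow> real"
    and g :: "'m \<Rightarrow> real ^ 'n \<Rightarrow> ereal"
    and F :: "'m \<Rightarrow> real ^ 'n \<Rightarrow> ereal"
    and L :: "'m \<Rightarrow> real"
    and \<tau> \<alpha>min \<alpha>max :: real
    and xm1 :: "real ^ 'n" and x :: "nat \<Rightarrow> real ^ 'n"
  assumes "\<And>i. continuously_differentiable (f i)"
    and "\<And>i. smooth_with (L i) (f i)"
    and "\<And>i. proper (g i)"
    and "\<And>i. ereal_convex (g i)"
    and "\<And>i. lower_semicontinuous (g i)"
    and "F = objective f g"
    and "\<And>i. F i (x 0) < \<infinity>"
    and "bounded (level_set F (x 0))"
    and "\<tau> > 1" and "0 < \<alpha>min" and "\<alpha>min < \<alpha>max"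
    and "abbpgmo_run f g \<tau> \<alpha>min \<alpha>max xm1 x"
    and "\<And>k. \<not> pareto_critical F (x k)"
  shows "((\<exists>xs. accumulation_point x xs) \<and>
          (\<forall>xs. accumulation_point x xs \<longrightarrow> xs \<in> level_set F (x 0) \<and> pareto_critical F xs)) \<and>
         (\<exists>Fstar :: 'm \<Rightarrow> real.
            (\<forall>i. (\<lambda>k. F i (x k)) \<longlonglongrightarrow> ereal (Fstar i)) \<and>
            (\<forall>k\<ge>1. (MIN s\<in>{0..k-1}. norm (x (Suc s) - x s)) \<le>
                sqrt (2 * (MIN i. real_of_ereal (F i (x 0)) - Fstar i)) / (sqrt \<alpha>min * sqrt (real k))))"
proof -
  note cd = assms(1) and sm = assms(2) and pr = assms(3) and cv = assms(4) and lsc = assms(5)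
  have step: "abbpgmo_step f g \<tau> \<alpha>min \<alpha>max (case k of 0 \<Rightarrow> xm1 | Suc j \<Rightarrow> x j) (x k) (x (Suc k))" for k
    using assms(12) by (simp add: abbpgmo_run_def)
  \<comment> \<open>Finiteness starts at \<open>x 0\<close> by assumption and is passed on because
    each subproblem solution lies in all domains.\<close>
  have "\<exists>v. \<forall>i. g i (x k) = ereal (v i)" for k
  proof (induction k)
    case 0
    have "\<exists>w. g i (x 0) = ereal w" for i
      using assms(7)[of i] pr[of i] by (cases "g i (x 0)") (auto simp: assms(6) objective_def proper_def)
    then show ?case by metis
  next
    case (Suc k)
    then obtain v where "\<And>i. g i (x k) = ereal (v i)" by blast
    from abbpgmo_step_decrease[where f = f and g = g, OF step cd sm pr cv assms(9-11) this]
    show ?case by metis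
  qed
  then obtain V' where V': "\<And>k i. g i (x k) = ereal (V' k i)" by metis
  define V where "V i k = V' k i" for i k
  have V: "g i (x k) = ereal (V i k)" for i k by (simp add: V' V_def)
  define a where "a i k = f i (x k) + V i k" for i k
  have Fa: "F i (x k) = ereal (a i k)" for i k by (simp add: assms(6) objective_def V a_def)
  have "\<exists>\<alpha> \<theta>. (\<forall>i. \<alpha>min \<le> \<alpha> i \<and> \<alpha> i \<le> max \<alpha>max (\<tau> * L i)) \<and>
      (\<forall>y. ereal \<theta> \<le> prox_obj f g \<alpha> (x k) y) \<and> \<theta> \<le> - (norm (x (Suc k) - x k))\<^sup>2 / 2 \<and>
      (\<forall>i. a i (Suc k) \<le> a i k + \<alpha>min * \<theta>)" for k
  proof -
    obtain \<alpha> u \<theta> where *: "\<And>i. \<alpha>min \<le> \<alpha> i \<and> \<alpha> i \<le> max \<alpha>max (\<tau> * L i)"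
      "\<And>i. g i (x (Suc k)) = ereal (u i)" "\<And>y. ereal \<theta> \<le> prox_obj f g \<alpha> (x k) y"
      "\<theta> \<le> - (norm (x (Suc k) - x k))\<^sup>2 / 2"
      "\<And>i. f i (x (Suc k)) + u i \<le> f i (x k) + V i k + \<alpha>min * \<theta>"
      using abbpgmo_step_decrease[where f = f and g = g, OF step cd sm pr cv assms(9-11) V] by metis
    moreover have "u i = V i (Suc k)" for i using *(2)[of i] V[of i "Suc k"] by simp
    ultimately show ?thesis unfolding a_def by metis
  qed
  then obtain \<alpha> \<theta> where \<alpha>: "\<And>k i. \<alpha>min \<le> \<alpha> k i" "\<And>k i. \<alpha> k i \<le> max \<alpha>max (\<tau> * L i)"
    and \<theta>: "\<And>k y. ereal (\<theta> k) \<le> prox_obj f g (\<alpha> k) (x k) y"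
      "\<And>k. \<theta> k \<le> - (norm (x (Suc k) - x k))\<^sup>2 / 2"
    and a_Suc: "\<And>k i. a i (Suc k) \<le> a i k + \<alpha>min * \<theta> k"
    by metis
  have \<theta>0: "\<theta> k \<le> 0" for k using \<theta>(2)[of k] by (smt (verit) divide_nonneg_pos zero_le_power2 minus_divide_left)
  have dec: "decseq (a i)" for i
  proof (rule decseq_SucI)
    show "a i (Suc k) \<le> a i k" for k
      using a_Suc[of i k] \<theta>0[of k] assms(10) by (smt (verit) mult_nonneg_nonpos)
  qed
  have level: "x k \<in> level_set F (x 0)" for k
    using dec by (auto simp: level_set_def Fa decseq_def)
  have fcont: "isCont (f i) z" for i z
    using cd[of i] by (auto simp: continuously_differentiable_def gderiv_def intro: has_derivative_continuous)
  have lim: "g i xs \<le> ereal (a i k - f i xs)" if "strict_mono r" "(x \<circ> r) \<longlonglongrightarrow> xs" for xs r i k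
    using decseq_lsc_bound[where h = "f i" and G = "g i" and v = "V i", OF fcont lsc V _ that] dec
    by (simp add: a_def[abs_def])
  have "bounded (range x)" by (rule bounded_subset[OF assms(8)]) (use level in auto)
  then obtain xs0 r0 where r0: "strict_mono r0" "(x \<circ> r0) \<longlonglongrightarrow> xs0"
    using bounded_imp_convergent_subsequence by blast
  \<comment> \<open>The objective value at the accumulation point \<open>xs0\<close>, finite by
    \<open>lim\<close> and properness, bounds the decreasing sequence \<open>a i\<close> from below;
    this is how boundedness of the level set yields real limits.\<close>
  have "\<exists>l. a i \<longlonglongrightarrow> l" for i
  proof -
    have "g i xs0 \<noteq> -\<infinity>" "g i xs0 \<noteq> \<infinity>" using pr lim[OF r0, of i 0] by (auto simp: proper_def)
    then obtain w where "g i xs0 = ereal w" by (cases "g i xs0") auto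
    then have "w + f i xs0 \<le> a i k" for k using lim[OF r0, of i k] by simp
    then show ?thesis using decseq_convergent[OF dec] by metis
  qed
  then obtain Fstar where Fstar: "\<And>i. a i \<longlonglongrightarrow> Fstar i" by metis
  \<comment> \<open>Squeezed between the vanishing differences of one convergent objective, divided
    by \<open>\<alpha>min\<close>, and 0; any index will do.\<close>
  have \<theta>lim: "\<theta> \<longlonglongrightarrow> 0"
  proof (rule tendsto_sandwich)
    show "(\<lambda>k. (a undefined (Suc k) - a undefined k) / \<alpha>min) \<longlonglongrightarrow> 0"
      using Fstar[of undefined] by (auto intro!: tendsto_eq_intros LIMSEQ_Suc simp: assms(10)[THEN less_imp_neq, symmetric])
    show "eventually (\<lambda>k. (a undefined (Suc k) - a undefined k) / \<alpha>min \<le> \<theta> k) sequentially"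
      using a_Suc[of undefined] assms(10) by (simp add: pos_divide_le_eq algebra_simps)
  qed (use \<theta>0 in auto)
  have acc: "xs \<in> level_set F (x 0) \<and> pareto_critical F xs" if "accumulation_point x xs" for xs
  proof -
    obtain r where r: "strict_mono r" "(x \<circ> r) \<longlonglongrightarrow> xs"
      using \<open>accumulation_point x xs\<close> by (auto simp: accumulation_point_def)
    have "\<exists>w. g i xs = ereal w" for i
      using lim[OF r, of i 0] pr[of i] by (cases "g i xs") (auto simp: proper_def)
    then obtain w where w: "\<And>i. g i xs = ereal (w i)" by metis
    have "xs \<in> level_set F (x 0)"
      using lim[OF r, of _ 0] by (auto simp: level_set_def Fa) (simp add: assms(6) objective_def w algebra_simps)
    moreover have "pareto_critical (objective f g) xs"
    proof (rule limit_of_prox_points_critical[where V = "\<lambda>i k. V i (r k)" and \<alpha> = "\<alpha> \<circ> r" and \<theta> = "\<theta> \<circ> r",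
          OF cd cv pr lsc w r(2)])
      show "0 < (\<alpha> \<circ> r) k i \<and> (\<alpha> \<circ> r) k i \<le> (MAX i. max \<alpha>max (\<tau> * L i))" for k i
      proof -
        have "max \<alpha>max (\<tau> * L i) \<le> (MAX i. max \<alpha>max (\<tau> * L i))" by (rule Max_ge) auto
        then show ?thesis using \<alpha>[of "r k" i] assms(10) by (auto simp del: Max_ge)
      qed
      show "(\<theta> \<circ> r) \<longlonglongrightarrow> 0" by (rule LIMSEQ_subseq_LIMSEQ[OF \<theta>lim r(1)])
    qed (use V \<theta>(1) in auto)
    ultimately show ?thesis by (simp add: assms(6))
  qed
  have rate: "(MIN s\<in>{0..k-1}. norm (x (Suc s) - x s)) \<le>
      sqrt (2 * (MIN i. real_of_ereal (F i (x 0)) - Fstar i)) / (sqrt \<alpha>min * sqrt (real k))" if k: "k \<ge> 1" for k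
  proof -
    define M where "M = (MIN s\<in>{0..k-1}. norm (x (Suc s) - x s))"
    have "M \<in> (\<lambda>s. norm (x (Suc s) - x s)) ` {0..k-1}" unfolding M_def by (rule Min_in) auto
    then have M0: "0 \<le> M" by auto
    have Mle: "M \<le> norm (x (Suc s) - x s)" if "s < k" for s
      unfolding M_def using that by (intro Min_le) auto
    \<comment> \<open>The telescoped decrease, with every step length before index \<open>k\<close>
      replaced by the minimum \<open>M\<close>. As \<open>k \<ge> 1\<close>, the set
      \<open>{0..k-1}\<close> consists exactly of the indices below \<open>k\<close>.\<close>
    have sum: "a i j + real j * (\<alpha>min * M\<^sup>2 / 2) \<le> a i 0" if "j \<le> k" for i j
      using that
    proof (induction j)
      case (Suc j)
      have "M\<^sup>2 \<le> (norm (x (Suc j) - x j))\<^sup>2" using Mle[of j] M0 Suc.prems by (intro power_mono) auto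
      then have "\<theta> j \<le> - M\<^sup>2 / 2" using \<theta>(2)[of j] by simp
      then have "\<alpha>min * \<theta> j \<le> \<alpha>min * (- M\<^sup>2 / 2)" using assms(10) by (intro mult_left_mono) auto
      then show ?case using a_Suc[of i j] Suc by (simp add: field_simps)
    qed simp
    \<comment> \<open>A decreasing sequence stays above its limit. The left side is independent of
      \<open>i\<close>, so the minimum over \<open>i\<close> may be taken on the right.\<close>
    have "real k * (\<alpha>min * M\<^sup>2 / 2) \<le> a i 0 - Fstar i" for i
      using sum[of k i] decseq_ge[OF dec Fstar, of i k] by simp
    then have "real k * (\<alpha>min * M\<^sup>2 / 2) \<le> (MIN i. real_of_ereal (F i (x 0)) - Fstar i)"
      by (subst Min_ge_iff) (auto simp: Fa)
    then have "\<alpha>min * real k * M\<^sup>2 \<le> 2 * (MIN i. real_of_ereal (F i (x 0)) - Fstar i)" by (simp add: mult_ac)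
    then have "sqrt (\<alpha>min * real k * M\<^sup>2) \<le> sqrt (2 * (MIN i. real_of_ereal (F i (x 0)) - Fstar i))"
      by (rule real_sqrt_le_mono)
    then have "M * (sqrt \<alpha>min * sqrt (real k)) \<le> sqrt (2 * (MIN i. real_of_ereal (F i (x 0)) - Fstar i))"
      using M0 by (simp add: real_sqrt_mult mult.commute)
    then show ?thesis
      unfolding M_def[symmetric] using k assms(10) by (simp add: pos_le_divide_eq)
  qed
  have "(\<lambda>k. F i (x k)) \<longlonglongrightarrow> ereal (Fstar i)" for i
    using Fstar by (simp add: Fa)
  then show ?thesis
    using acc rate r0 unfolding accumulation_point_def by blast
qed

end
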